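(* Let $n\ge 1$ and let $m=p_1\cdots p_l$ be square-free, with $p_1,\dots,p_l$ distinct primes. Then $$f(\underbrace{1,\dots,1}_{n-1},m)=\prod_{k=1}^l\frac{p_k^n-1}{p_k-1}.$$
   Context: An $n$-dimensional lattice is the $\mathbb{Z}$-span of $n$ linearly independent vectors in a Euclidean space; a sublattice of $\Lambda$ is a subset of $\Lambda$ which is itself an $n$-dimensional lattice. The invariant factors of a sublattice $\Lambda^*$ of $\Lambda$ are the diagonal entries $d_1\mid\cdots\mid d_n$ (positive integers) of the Smith normal form of the integer matrix expressing a basis of $\Lambda^*$ in a basis of $\Lambda$; they do not depend on the choices of bases. $f(d_1,\dots,d_n)$ is the number of sublattices of an $n$-dimensional lattice $\Lambda$ with invariant factors $d_1,\dots,d_n$ (this does not depend on $\Lambda$). In particular $f(1,\dots,1,m)$ (with $n-1$ ones) is the number of co-cyclic sublattices of index $m$, where $\Lambda^*$ is called co-cyclic if $\Lambda/\Lambda^*$ is a finite cyclic group. *)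

theory Defs
  imports "HOL-Analysis.Euclidean_Space" "Jordan_Normal_Form.Matrix"
    "HOL-Computational_Algebra.Primes"
begin

definition lattice_basis :: "'a::euclidean_space list \<Rightarrow> 'a set \<Rightarrow> bool" where
  "lattice_basis bs \<Lambda> \<longleftrightarrow>
     distinct bs \<and> independent (set bs) \<and>
     \<Lambda> = range (\<lambda>c :: nat \<Rightarrow> int. \<Sum>i<length bs. of_int (c i) *\<^sub>R bs ! i)"

text \<open>The rank \<open>n\<close> may be smaller than the dimension of the ambient Euclidean space.\<close>

definition is_lattice :: "nat \<Rightarrow> 'a::euclidean_space set \<Rightarrow> bool" where
  "is_lattice n \<Lambda> \<longleftrightarrow> (\<exists>bs. length bs = n \<and> lattice_basis bs \<Lambda>)"

text \<open>A sublattice has the same rank as the lattice containing it.\<close>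

definition is_sublattice :: "nat \<Rightarrow> 'a::euclidean_space set \<Rightarrow> 'a set \<Rightarrow> bool" where
  "is_sublattice n M \<Lambda> \<longleftrightarrow> M \<subseteq> \<Lambda> \<and> is_lattice n M"

text \<open>Row \<open>i\<close> of \<open>A\<close> holds the coordinates of \<open>cs ! i\<close> with respect to \<open>bs\<close>.\<close>

definition expresses_basis :: "int mat \<Rightarrow> 'a::euclidean_space list \<Rightarrow> 'a list \<Rightarrow> bool" where
  "expresses_basis A cs bs \<longleftrightarrow>
     A \<in> carrier_mat (length cs) (length bs) \<and>
     (\<forall>i<length cs. cs ! i = (\<Sum>j<length bs. of_int (A $$ (i, j)) *\<^sub>R bs ! j))"

text \<open>Smith normal form of a nonsingular square integer matrix, given by its list of
  (positive) diagonal entries. Invertibility is over the integers, so \<open>P\<close> and \<open>Q\<close>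
  are unimodular.\<close>

definition has_smith_normal_form :: "int mat \<Rightarrow> nat list \<Rightarrow> bool" where
  "has_smith_normal_form A ds \<longleftrightarrow>
     A \<in> carrier_mat (length ds) (length ds) \<and>
     (\<forall>d\<in>set ds. 0 < d) \<and>
     (\<forall>i. Suc i < length ds \<longrightarrow> ds ! i dvd ds ! Suc i) \<and>
     (\<exists>P Q. P \<in> carrier_mat (length ds) (length ds) \<and> invertible_mat P \<and>
            Q \<in> carrier_mat (length ds) (length ds) \<and> invertible_mat Q \<and>
            P * A * Q = mat_diag (length ds) (\<lambda>i. int (ds ! i)))"

text \<open>Different choices of the two bases change the coordinate matrix only by unimodular
  factors on either side, so it does not matter which bases are used.\<close>

definition has_invariant_factors ::
    "'a::euclidean_space set \<Rightarrow> 'a set \<Rightarrow> nat list \<Rightarrow> bool" where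
  "has_invariant_factors M \<Lambda> ds \<longleftrightarrow>
     (\<exists>bs cs A. length bs = length ds \<and> length cs = length ds \<and>
        lattice_basis bs \<Lambda> \<and> lattice_basis cs M \<and>
        expresses_basis A cs bs \<and> has_smith_normal_form A ds)"

text \<open>The counting function \<open>f(d\<^sub>1, \<dots>, d\<^sub>n)\<close>. Its value does not depend on
  the \<open>n\<close>-dimensional lattice \<open>\<Lambda>\<close>, which is kept as a parameter.\<close>

definition num_sublattices :: "'a::euclidean_space set \<Rightarrow> nat list \<Rightarrow> nat" where
  "num_sublattices \<Lambda> ds =
     card {M. is_sublattice (length ds) M \<Lambda> \<and> has_invariant_factors M \<Lambda> ds}"

end

theory Submission
  imports Defs "HOL-Number_Theory.Cong"
begin

text \<open>A sublattice \<open>M\<close> of \<open>\<Lambda>\<close> with invariant factors \<open>1, \<dots>, 1, m\<close> is the kernel of a surjection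
  from \<open>\<Lambda>\<close> onto \<open>\<int>/m\<close>. In coordinates for a fixed basis of \<open>\<Lambda>\<close>, it is the solution set of one
  congruence \<open>v\<^sub>1 c\<^sub>1 + \<dots> + v\<^sub>n c\<^sub>n \<equiv> 0\<close> modulo \<open>m\<close>, where no prime divisor of \<open>m\<close> divides all
  \<open>v\<^sub>i\<close>. The proof of this correspondence (\<open>cocyclic_sublattices_eq\<close>) has two halves. The Smith
  normal form gives a basis of \<open>\<Lambda>\<close> in which only the last coordinate is constrained
  (\<open>has_invariant_factors_iff_stacked_basis\<close>), and this last coordinate, evaluated on the fixed
  basis, gives \<open>v\<close>. Conversely, the Euclidean algorithm changes the fixed basis into one on which
  the functional given by \<open>v\<close> vanishes except at the last vector
  (\<open>lattice_basis_concentrating_functional\<close>). Its value there is a unit modulo \<open>m\<close>, so the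
  congruence constrains only the last coordinate.

  It remains to count the solution sets of such congruences. For coprime moduli, solution sets
  modulo \<open>m * q\<close> correspond to pairs of solution sets modulo \<open>m\<close> and \<open>q\<close> by intersection
  (\<open>card_primitive_congruence_sets_mult\<close>), so a square-free modulus reduces to its prime factors.
  Modulo a prime \<open>p\<close> the solution sets are the hyperplanes of an \<open>n\<close>-dimensional space over the
  field with \<open>p\<close> elements. Each has exactly one equation whose first nonzero coefficient is 1,
  so there are \<open>1 + p + \<dots> + p ^ (n - 1)\<close> of them (\<open>card_primitive_congruence_sets_prime\<close>).\<close>

section \<open>Counting congruence conditions on integer vectors\<close>

text \<open>Integer vectors are functions on \<open>nat\<close> of which only the entries below \<open>n\<close> matter,
  so a congruence set is a union of classes of functions that agree below \<open>n\<close>.\<close>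
definition congruence_set :: "nat \<Rightarrow> nat \<Rightarrow> (nat \<Rightarrow> int) \<Rightarrow> (nat \<Rightarrow> int) set" where
  "congruence_set n m v = {c. int m dvd (\<Sum>i<n. v i * c i)}"

text \<open>The residues of \<open>v\<close> generate the unit ideal of \<open>\<int>/m\<close>; equivalently, pairing with
  \<open>v\<close> maps \<open>\<int>\<^sup>n\<close> onto \<open>\<int>/m\<close>.\<close>
definition primitive_mod :: "nat \<Rightarrow> nat \<Rightarrow> (nat \<Rightarrow> int) \<Rightarrow> bool" where
  "primitive_mod n m v \<longleftrightarrow> (\<forall>q. prime q \<longrightarrow> q dvd m \<longrightarrow> (\<exists>i<n. \<not> int q dvd v i))"

definition primitive_congruence_sets :: "nat \<Rightarrow> nat \<Rightarrow> (nat \<Rightarrow> int) set set" where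
  "primitive_congruence_sets n m = congruence_set n m ` {v. primitive_mod n m v}"

lemma congruence_set_cong:
  assumes "\<And>i. i < n \<Longrightarrow> [v i = w i] (mod int m)"
  shows "congruence_set n m v = congruence_set n m w"
proof -
  have "[(\<Sum>i<n. v i * c i) = (\<Sum>i<n. w i * c i)] (mod int m)" for c
    by (intro cong_sum cong_mult assms) auto
  then have "int m dvd (\<Sum>i<n. v i * c i) \<longleftrightarrow> int m dvd (\<Sum>i<n. w i * c i)" for c
    by (rule cong_dvd_iff)
  then show ?thesis
    by (simp add: congruence_set_def)
qed

lemma congruence_set_scale:
  assumes "coprime u (int m)"
  shows "congruence_set n m (\<lambda>i. u * v i) = congruence_set n m v"
proof -
  have "int m dvd (\<Sum>i<n. u * v i * c i) \<longleftrightarrow> int m dvd (\<Sum>i<n. v i * c i)" for c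
  proof -
    have "(\<Sum>i<n. u * v i * c i) = u * (\<Sum>i<n. v i * c i)"
      by (simp add: sum_distrib_left mult.assoc)
    then show ?thesis
      using assms by (simp add: coprime_dvd_mult_right_iff coprime_commute)
  qed
  then show ?thesis by (simp add: congruence_set_def)
qed

lemma primitive_mod_cong:
  assumes "\<And>i. i < n \<Longrightarrow> [v i = w i] (mod int m)" and "primitive_mod n m w"
  shows "primitive_mod n m v"
  unfolding primitive_mod_def
proof (intro allI impI)
  fix q assume q: "prime q" "q dvd m"
  then obtain i where i: "i < n" "\<not> int q dvd w i"
    using assms(2) unfolding primitive_mod_def by blast
  have "[v i = w i] (mod int q)"
    using assms(1)[OF i(1)] q(2) by (meson cong_dvd_modulus of_nat_dvd_iff)
  then show "\<exists>i<n. \<not> int q dvd v i"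
    using i cong_dvd_iff by blast
qed

text \<open>A congruence set determines its covector up to a factor modulo \<open>m\<close>: the vector
  \<open>v\<^sub>j e\<^sub>i - v\<^sub>i e\<^sub>j\<close> is orthogonal to \<open>v\<close>, so it lies in the congruence set of \<open>v\<close>,
  and membership in that of \<open>w\<close> is the vanishing of a two-by-two minor modulo \<open>m\<close>.\<close>
lemma congruence_set_eq_imp_proportional:
  assumes "congruence_set n m v = congruence_set n m w" and "i < n" "j < n"
  shows "int m dvd v j * w i - v i * w j"
proof -
  define c where "c k = (if k = i then v j else 0) - (if k = j then v i else 0)" for k
  have dot: "(\<Sum>k<n. u k * c k) = u i * v j - u j * v i" for u :: "nat \<Rightarrow> int"
  proof -
    have "(\<Sum>k<n. u k * c k) =
        (\<Sum>k<n. (if k = i then u k * v j else 0) - (if k = j then u k * v i else 0))"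
      by (intro sum.cong) (auto simp: c_def algebra_simps)
    also have "\<dots> = u i * v j - u j * v i"
      using assms(2,3) by (simp add: sum_subtractf)
    finally show ?thesis .
  qed
  have "c \<in> congruence_set n m v"
    by (simp add: congruence_set_def dot)
  then have "c \<in> congruence_set n m w"
    using assms(1) by simp
  then have "int m dvd w i * v j - w j * v i"
    by (simp add: congruence_set_def dot)
  then show ?thesis by (simp add: mult.commute)
qed

text \<open>Row echelon representatives, with leading entry at position \<open>j\<close>, of the points of
  projective space over the field with \<open>p\<close> elements, for prime \<open>p\<close>.\<close>
definition normalized_covectors :: "nat \<Rightarrow> nat \<Rightarrow> nat \<Rightarrow> (nat \<Rightarrow> int) set" where
  "normalized_covectors n p j =
     (\<Pi>\<^sub>E i\<in>{..<n}. if i < j then {0} else if i = j then {1} else {0..<int p})"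

lemma card_normalized_covectors:
  assumes "j < n"
  shows "card (normalized_covectors n p j) = p ^ (n - 1 - j)"
proof -
  have "card (normalized_covectors n p j) =
      (\<Prod>i<n. if i < j then 1 else if i = j then 1 else p)"
    unfolding normalized_covectors_def by (subst card_PiE) (auto intro!: prod.cong)
  also have "\<dots> = (\<Prod>i<n. if i \<in> {j<..<n} then p else 1)"
    by (intro prod.cong) auto
  also have "\<dots> = (\<Prod>i\<in>{..<n} \<inter> {j<..<n}. p)"
    by (rule prod.inter_restrict[symmetric]) simp
  also have "{..<n} \<inter> {j<..<n} = {j<..<n}"
    by auto
  finally show ?thesis by simp
qed

lemma finite_normalized_covectors: "finite (normalized_covectors n p j)"
  unfolding normalized_covectors_def by (intro finite_PiE) auto

lemma normalized_covectors_lead: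
  assumes "v \<in> normalized_covectors n p j" "j < n"
  shows "v j = 1" "i < j \<Longrightarrow> v i = 0"
  using assms by (auto simp: normalized_covectors_def PiE_iff split: if_splits)

lemma normalized_covectors_bounds:
  assumes "v \<in> normalized_covectors n p j" "i < n" "p > 1"
  shows "0 \<le> v i" "v i < int p"
proof -
  have "v i \<in> (if i < j then {0} else if i = j then {1} else {0..<int p})"
    using assms(1,2) by (auto simp: normalized_covectors_def PiE_iff)
  then show "0 \<le> v i" "v i < int p"
    using assms(3) by (auto split: if_splits)
qed

text \<open>If the leading entry of \<open>v\<close> came strictly before that of \<open>w\<close>, the minor of the two
  leading columns would be 1, which \<open>p\<close> does not divide.\<close>
lemma normalized_covectors_lead_unique:
  assumes "p > 1" and "v \<in> normalized_covectors n p j" "w \<in> normalized_covectors n p k"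
    and "j < n" "k < n" and "congruence_set n p v = congruence_set n p w"
  shows "j \<ge> k"
proof (rule ccontr)
  assume "\<not> j \<ge> k"
  then have "w j = 0" "w k = 1" "v j = 1"
    using normalized_covectors_lead[OF assms(2,4)] normalized_covectors_lead[OF assms(3,5)]
    by auto
  then have "int p dvd 1"
    using congruence_set_eq_imp_proportional[OF assms(6,5,4)] by simp
  then show False using assms(1) by simp
qed

lemma inj_on_normalized_covectors:
  assumes "p > 1"
  shows "inj_on (congruence_set n p) (\<Union>j<n. normalized_covectors n p j)"
proof (rule inj_onI)
  fix v w
  assume "v \<in> (\<Union>j<n. normalized_covectors n p j)" "w \<in> (\<Union>j<n. normalized_covectors n p j)"
    and eq: "congruence_set n p v = congruence_set n p w"
  then obtain j k where j: "j < n" "v \<in> normalized_covectors n p j"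
    and k: "k < n" "w \<in> normalized_covectors n p k"
    by auto
  have "j = k"
    using normalized_covectors_lead_unique[OF assms j(2) k(2) j(1) k(1) eq]
      normalized_covectors_lead_unique[OF assms k(2) j(2) k(1) j(1) eq[symmetric]] by simp
  show "v = w"
  proof (rule PiE_ext)
    show "v \<in> (\<Pi>\<^sub>E i\<in>{..<n}. if i < j then {0} else if i = j then {1} else {0..<int p})"
      using j(2) by (simp add: normalized_covectors_def)
    show "w \<in> (\<Pi>\<^sub>E i\<in>{..<n}. if i < j then {0} else if i = j then {1} else {0..<int p})"
      using k(2) unfolding \<open>j = k\<close> normalized_covectors_def .
    fix i assume i: "i \<in> {..<n}"
    have "int p dvd w i - v i"
      using congruence_set_eq_imp_proportional[OF eq _ j(1), of i] i
        normalized_covectors_lead[OF j(2,1)] normalized_covectors_lead[OF k(2,1)] \<open>j = k\<close>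
      by simp
    then have "w i mod int p = v i mod int p"
      by (simp add: mod_eq_dvd_iff)
    then show "v i = w i"
      using normalized_covectors_bounds[OF j(2) _ assms, of i]
        normalized_covectors_bounds[OF k(2) _ assms, of i] i by simp
  qed
qed

text \<open>Modulo a prime the first nonzero entry of a covector is invertible, and scaling by its
  inverse changes neither the congruence set nor the vanishing of the earlier entries.\<close>
lemma normalized_covectors_image:
  assumes "prime p"
  shows "congruence_set n p ` (\<Union>j<n. normalized_covectors n p j) = primitive_congruence_sets n p"
proof (intro equalityI subsetI)
  fix S assume "S \<in> congruence_set n p ` (\<Union>j<n. normalized_covectors n p j)"
  then obtain j v where j: "j < n" "v \<in> normalized_covectors n p j" and S: "S = congruence_set n p v"
    by auto
  have "primitive_mod n p v"
    unfolding primitive_mod_def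
  proof (intro allI impI)
    fix q assume "prime q" "q dvd p"
    then have "\<not> int q dvd v j"
      using normalized_covectors_lead(1)[OF j(2,1)] prime_gt_1_nat[of q] by simp
    then show "\<exists>i<n. \<not> int q dvd v i" using j(1) by blast
  qed
  then show "S \<in> primitive_congruence_sets n p"
    by (simp add: primitive_congruence_sets_def S)
next
  fix S assume "S \<in> primitive_congruence_sets n p"
  then obtain v where v: "primitive_mod n p v" and S: "S = congruence_set n p v"
    by (auto simp: primitive_congruence_sets_def)
  let ?P = "\<lambda>i. i < n \<and> \<not> int p dvd v i"
  define j where "j = (LEAST i. ?P i)"
  have "\<exists>i. ?P i"
    using v assms unfolding primitive_mod_def by (metis dvd_refl)
  then have j: "?P j" unfolding j_def by (rule LeastI_ex)
  have before_j: "int p dvd v i" if "i < j" for i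
    using not_less_Least[of i ?P] that j unfolding j_def by auto
  have "coprime (v j) (int p)"
    using j assms by (metis coprime_commute prime_imp_coprime_int prime_nat_int_transfer)
  then obtain u where u: "[v j * u = 1] (mod int p)"
    using cong_solve_coprime_int by blast
  then have "coprime u (int p)"
    by (metis coprime_1_left coprime_mult_left_iff cong_imp_coprime cong_sym)
  define w where "w = (\<lambda>i\<in>{..<n}. u * v i mod int p)"
  have "congruence_set n p w = congruence_set n p (\<lambda>i. u * v i)"
    by (intro congruence_set_cong) (simp add: w_def cong_def)
  also have "\<dots> = S"
    unfolding S by (rule congruence_set_scale) fact
  finally have "congruence_set n p w = S" .
  moreover have "w \<in> normalized_covectors n p j"
  proof -
    have p: "int p > 1" using assms prime_gt_1_nat by simp
    have "u * v j mod int p = 1"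
      using u p by (simp add: cong_def mult.commute)
    moreover have "u * v i mod int p = 0" if "i < j" for i
      using before_j[OF that] by simp
    ultimately show ?thesis
      using p by (auto simp: normalized_covectors_def w_def)
  qed
  ultimately show "S \<in> congruence_set n p ` (\<Union>j<n. normalized_covectors n p j)"
    using j by blast
qed

text \<open>There are \<open>p ^ (n - 1 - j)\<close> normalized covectors with leading position \<open>j\<close>, and these
  powers add up to a geometric sum.\<close>
lemma card_primitive_congruence_sets_prime:
  assumes "prime p"
  shows "real (card (primitive_congruence_sets n p)) = (real p ^ n - 1) / (real p - 1)"
proof -
  have p: "p > 1" using assms by (rule prime_gt_1_nat)
  have disjoint: "normalized_covectors n p j \<inter> normalized_covectors n p k = {}"
    if "j < n" "k < n" "j \<noteq> k" for j k
    using normalized_covectors_lead_unique[OF p] that by (metis disjoint_iff order_antisym)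
  have "card (primitive_congruence_sets n p) = card (\<Union>j<n. normalized_covectors n p j)"
    using card_image[OF inj_on_normalized_covectors[OF p]] normalized_covectors_image[OF assms]
    by metis
  also have "\<dots> = (\<Sum>j<n. card (normalized_covectors n p j))"
    by (intro card_UN_disjoint) (use disjoint finite_normalized_covectors in auto)
  also have "\<dots> = (\<Sum>j<n. p ^ (n - 1 - j))"
    by (intro sum.cong) (auto simp: card_normalized_covectors)
  also have "\<dots> = (\<Sum>j<n. p ^ j)"
    by (rule sum.reindex_bij_witness[of _ "\<lambda>j. n - 1 - j" "\<lambda>j. n - 1 - j"]) auto
  finally have "real (card (primitive_congruence_sets n p)) = (\<Sum>j<n. real p ^ j)"
    by simp
  also have "\<dots> = (real p ^ n - 1) / (real p - 1)"
    using p by (intro geometric_sum) auto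
  finally show ?thesis .
qed

lemma primitive_mod_mult:
  "primitive_mod n (m * q) v \<longleftrightarrow> primitive_mod n m v \<and> primitive_mod n q v"
  unfolding primitive_mod_def by (metis dvd_mult dvd_mult2 prime_dvd_mult_iff)

lemma congruence_set_mult:
  assumes "coprime m q"
  shows "congruence_set n (m * q) v = congruence_set n m v \<inter> congruence_set n q v"
proof -
  have "int (m * q) dvd x \<longleftrightarrow> int m dvd x \<and> int q dvd x" for x
    using assms by (auto intro: divides_mult dest: dvd_mult_left dvd_mult_right)
  then show ?thesis by (auto simp: congruence_set_def)
qed

text \<open>Multiplication by \<open>q\<close> makes the condition modulo \<open>q\<close> automatic and, because \<open>q\<close> is
  invertible modulo \<open>m\<close>, leaves the condition modulo \<open>m\<close> unchanged. Hence an intersection of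
  a congruence set modulo \<open>m\<close> with one modulo \<open>q\<close> determines both of them.\<close>
lemma congruence_set_recover:
  assumes "coprime m q"
  shows "congruence_set n m v =
    {c. (\<lambda>i. int q * c i) \<in> congruence_set n m v \<inter> congruence_set n q w}"
proof -
  have dot: "(\<Sum>i<n. u i * (int q * c i)) = int q * (\<Sum>i<n. u i * c i)" for u c
    by (simp add: sum_distrib_left mult_ac)
  show ?thesis
    using assms by (simp add: congruence_set_def dot coprime_dvd_mult_right_iff)
qed

text \<open>Intersection is a bijection from pairs of congruence sets modulo \<open>m\<close> and \<open>q\<close> to
  congruence sets modulo \<open>m * q\<close>. The Chinese remainder theorem combines the two covectors
  into one.\<close>
lemma card_primitive_congruence_sets_mult:
  assumes "coprime m q"
  shows "card (primitive_congruence_sets n (m * q)) =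
    card (primitive_congruence_sets n m) * card (primitive_congruence_sets n q)"
proof -
  let ?P = "primitive_congruence_sets n"
  have "bij_betw (\<lambda>(S, T). S \<inter> T) (?P m \<times> ?P q) (?P (m * q))"
  proof (rule bij_betw_imageI)
    show "inj_on (\<lambda>(S, T). S \<inter> T) (?P m \<times> ?P q)"
    proof (rule inj_onI, clarify)
      fix S T S' T'
      assume "S \<in> ?P m" "T \<in> ?P q" "S' \<in> ?P m" "T' \<in> ?P q" and eq: "S \<inter> T = S' \<inter> T'"
      then obtain v w v' w' where
        S: "S = congruence_set n m v" and T: "T = congruence_set n q w" and
        S': "S' = congruence_set n m v'" and T': "T' = congruence_set n q w'"
        by (auto simp: primitive_congruence_sets_def)
      have "S = S'"
        using congruence_set_recover[OF assms, of n v w] congruence_set_recover[OF assms, of n v' w']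
          eq unfolding S T S' T' by simp
      moreover have "T = T'"
        using congruence_set_recover[of q m n w v] congruence_set_recover[of q m n w' v']
          eq assms unfolding S T S' T' by (simp add: coprime_commute Int_commute)
      ultimately show "S = S' \<and> T = T'" by simp
    qed
    show "(\<lambda>(S, T). S \<inter> T) ` (?P m \<times> ?P q) = ?P (m * q)"
    proof (intro equalityI subsetI)
      fix S assume "S \<in> (\<lambda>(S, T). S \<inter> T) ` (?P m \<times> ?P q)"
      then obtain v w where S: "S = congruence_set n m v \<inter> congruence_set n q w"
        and prim: "primitive_mod n m v" "primitive_mod n q w"
        by (auto simp: primitive_congruence_sets_def)
      have "\<exists>x. [x = v i] (mod int m) \<and> [x = w i] (mod int q)" for i
        using binary_chinese_remainder_int assms by simp
      then obtain x where x: "\<And>i. [x i = v i] (mod int m)" "\<And>i. [x i = w i] (mod int q)"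
        by metis
      have "S = congruence_set n (m * q) x"
        unfolding S congruence_set_mult[OF assms]
        using congruence_set_cong[of n x v m] congruence_set_cong[of n x w q] x by simp
      moreover have "primitive_mod n (m * q) x"
        unfolding primitive_mod_mult using prim x primitive_mod_cong by blast
      ultimately show "S \<in> ?P (m * q)"
        by (simp add: primitive_congruence_sets_def)
    next
      fix S assume "S \<in> ?P (m * q)"
      then obtain v where "primitive_mod n m v" "primitive_mod n q v"
        and "S = congruence_set n m v \<inter> congruence_set n q v"
        by (auto simp: primitive_congruence_sets_def primitive_mod_mult congruence_set_mult[OF assms])
      then show "S \<in> (\<lambda>(S, T). S \<inter> T) ` (?P m \<times> ?P q)"
        by (auto simp: primitive_congruence_sets_def)
    qed
  qed
  from bij_betw_same_card[OF this] show ?thesis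
    by (simp add: card_cartesian_product)
qed

lemma card_primitive_congruence_sets_one: "card (primitive_congruence_sets n 1) = 1"
proof -
  have "primitive_mod n 1 v" for v
    by (auto simp: primitive_mod_def)
  then have "primitive_congruence_sets n 1 = {UNIV}"
    by (auto simp: primitive_congruence_sets_def congruence_set_def)
  then show ?thesis by simp
qed

lemma card_primitive_congruence_sets_squarefree:
  assumes "finite I" "\<And>k. k \<in> I \<Longrightarrow> prime (p k)" "inj_on p I"
  shows "real (card (primitive_congruence_sets n (\<Prod>k\<in>I. p k))) =
    (\<Prod>k\<in>I. (real (p k) ^ n - 1) / (real (p k) - 1))"
  using assms
proof (induction I)
  case empty
  then show ?case by (simp add: card_primitive_congruence_sets_one[simplified])
next
  case (insert k I)
  have "coprime (p k) (\<Prod>k\<in>I. p k)"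
  proof (rule prod_coprime_right)
    fix i assume "i \<in> I"
    then have "p k \<noteq> p i"
      using insert.hyps insert.prems(2) by (metis inj_onD insertCI)
    then show "coprime (p k) (p i)"
      using insert.prems(1) \<open>i \<in> I\<close> by (intro primes_coprime) auto
  qed
  from card_primitive_congruence_sets_mult[OF this] show ?case
    using insert by (simp add: card_primitive_congruence_sets_prime)
qed

section \<open>Integer combinations and changes of lattice basis\<close>

definition int_comb :: "'a::euclidean_space list \<Rightarrow> (nat \<Rightarrow> int) \<Rightarrow> 'a" where
  "int_comb bs c = (\<Sum>i<length bs. of_int (c i) *\<^sub>R bs ! i)"

lemma lattice_basis_int_comb:
  "lattice_basis bs \<Lambda> \<longleftrightarrow> distinct bs \<and> independent (set bs) \<and> \<Lambda> = range (int_comb bs)"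
  by (simp add: lattice_basis_def int_comb_def[abs_def])

lemma int_comb_cong:
  "(\<And>i. i < length bs \<Longrightarrow> c i = d i) \<Longrightarrow> int_comb bs c = int_comb bs d"
  by (simp add: int_comb_def)

lemma int_comb_nth:
  assumes "i < length bs"
  shows "int_comb bs (\<lambda>k. if k = i then 1 else 0) = bs ! i"
proof -
  have "int_comb bs (\<lambda>k. if k = i then 1 else 0) = (\<Sum>k<length bs. if k = i then bs ! k else 0)"
    unfolding int_comb_def by (intro sum.cong) auto
  then show ?thesis using assms by simp
qed

lemma int_comb_compose:
  assumes "\<And>i. i < length xs \<Longrightarrow> xs ! i = int_comb bs (R i)"
  shows "int_comb xs c = int_comb bs (\<lambda>j. \<Sum>i<length xs. c i * R i j)"
proof -
  have "int_comb xs c = (\<Sum>i<length xs. \<Sum>j<length bs. of_int (c i * R i j) *\<^sub>R bs ! j)"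
    unfolding int_comb_def[of xs]
    by (intro sum.cong refl) (simp add: assms int_comb_def scaleR_sum_right)
  also have "\<dots> = (\<Sum>j<length bs. \<Sum>i<length xs. of_int (c i * R i j) *\<^sub>R bs ! j)"
    by (rule sum.swap)
  also have "\<dots> = int_comb bs (\<lambda>j. \<Sum>i<length xs. c i * R i j)"
    by (simp add: int_comb_def scaleR_sum_left)
  finally show ?thesis .
qed

lemma range_int_comb_mono:
  assumes "set xs \<subseteq> range (int_comb bs)"
  shows "range (int_comb xs) \<subseteq> range (int_comb bs)"
proof -
  have "\<forall>i. \<exists>r. i < length xs \<longrightarrow> xs ! i = int_comb bs r"
    using assms nth_mem by blast
  then obtain R where "\<And>i. i < length xs \<Longrightarrow> xs ! i = int_comb bs (R i)"
    by metis
  from int_comb_compose[OF this] show ?thesis by auto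
qed

lemma int_comb_in_span: "int_comb bs c \<in> span (set bs)"
  unfolding int_comb_def by (intro span_sum span_scale span_base nth_mem) auto

lemma linear_int_comb:
  assumes "linear f"
  shows "f (int_comb bs c) = (\<Sum>i<length bs. of_int (c i) *\<^sub>R f (bs ! i))"
  using assms by (simp add: int_comb_def linear_sum linear_scale)

lemma linear_extend_list:
  fixes bs :: "'a::euclidean_space list" and g :: "nat \<Rightarrow> real"
  assumes "distinct bs" "independent (set bs)"
  obtains f where "linear f" "\<And>i. i < length bs \<Longrightarrow> f (bs ! i) = g i"
proof -
  define h where "h b = g (THE i. i < length bs \<and> bs ! i = b)" for b
  obtain f where f: "linear f" "\<forall>b\<in>set bs. f b = h b"
    using linear_independent_extend[OF assms(2), of h] by blast
  have "f (bs ! i) = g i" if "i < length bs" for i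
  proof -
    have "(THE k. k < length bs \<and> bs ! k = bs ! i) = i"
      using that assms(1) by (intro the_equality) (auto simp: nth_eq_iff_index_eq)
    then show ?thesis using f(2) that by (simp add: h_def)
  qed
  with f(1) show ?thesis using that by blast
qed

text \<open>Each coordinate of an integer combination is read off by a linear functional dual to the
  basis, so the coordinates are unique.\<close>
lemma int_comb_eq_iff:
  assumes "distinct bs" "independent (set bs)"
  shows "int_comb bs c = int_comb bs d \<longleftrightarrow> (\<forall>i<length bs. c i = d i)"
proof (intro iffI allI impI)
  fix i assume eq: "int_comb bs c = int_comb bs d" and i: "i < length bs"
  obtain f :: "'a \<Rightarrow> real" where f: "linear f" "\<And>k. k < length bs \<Longrightarrow> f (bs ! k) = (if k = i then 1 else 0)"
    using linear_extend_list[OF assms, of "\<lambda>k. if k = i then 1 else 0"] by auto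
  have "f (int_comb bs u) = of_int (u i)" for u
  proof -
    have "f (int_comb bs u) = (\<Sum>k<length bs. if k = i then of_int (u k) else 0)"
      unfolding linear_int_comb[OF f(1)] by (intro sum.cong) (auto simp: f(2))
    then show ?thesis using i by simp
  qed
  from this[of c] this[of d] show "c i = d i" by (simp add: eq)
qed (auto intro: int_comb_cong)

text \<open>A dimension count: a list that spans at least as much as an independent list of the same
  length can have neither repetitions nor linear relations. This spares every later change of
  basis a direct verification of independence.\<close>
lemma distinct_independent_if_spans:
  fixes bs :: "'a::euclidean_space list"
  assumes "distinct bs" "independent (set bs)" "length bs' = length bs"
    and "set bs \<subseteq> span (set bs')"
  shows "distinct bs' \<and> independent (set bs')"
proof -
  have "length bs = card (set bs)"
    using assms(1) by (simp add: distinct_card)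
  also have "\<dots> \<le> dim (span (set bs'))"
    using assms(4,2) by (rule independent_card_le_dim)
  finally have dim: "length bs \<le> dim (span (set bs'))" .
  then have "length bs \<le> card (set bs')"
    using dim_le_card'[of "set bs'"] by simp
  then have card: "card (set bs') = length bs'"
    using assms(3) card_length[of bs'] by simp
  then have "independent (set bs')"
    using dim assms(3) by (intro card_le_dim_spanning[of _ "span (set bs')"]) (auto intro: span_base)
  then show ?thesis using card card_distinct by blast
qed

lemma lattice_basis_exchange:
  fixes bs :: "'a::euclidean_space list"
  assumes "lattice_basis bs \<Lambda>" "length bs' = length bs" "set bs' \<subseteq> \<Lambda>"
    and "set bs \<subseteq> range (int_comb bs')"
  shows "lattice_basis bs' \<Lambda>"
proof -
  have bs: "distinct bs" "independent (set bs)" "\<Lambda> = range (int_comb bs)"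
    using assms(1) by (auto simp: lattice_basis_int_comb)
  have "set bs \<subseteq> span (set bs')"
    using assms(4) int_comb_in_span by blast
  then have "distinct bs' \<and> independent (set bs')"
    using distinct_independent_if_spans bs(1,2) assms(2) by blast
  moreover have "\<Lambda> = range (int_comb bs')"
    using range_int_comb_mono[of bs bs'] range_int_comb_mono[of bs' bs] assms(3,4)
    unfolding bs(3) by simp
  ultimately show ?thesis by (simp add: lattice_basis_int_comb)
qed

text \<open>The action of integer matrices on lists of vectors, for which a matrix product acts as
  the composition of its factors. It turns identities between basis matrices, such as
  \<open>P * A * Q = D\<close>, into identities between bases.\<close>
definition transform_list :: "int mat \<Rightarrow> 'a::euclidean_space list \<Rightarrow> 'a list" where
  "transform_list U bs = map (\<lambda>i. int_comb bs (\<lambda>j. U $$ (i, j))) [0..<dim_row U]"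

lemma length_transform_list [simp]: "length (transform_list U bs) = dim_row U"
  by (simp add: transform_list_def)

lemma transform_list_nth [simp]:
  "i < dim_row U \<Longrightarrow> transform_list U bs ! i = int_comb bs (\<lambda>j. U $$ (i, j))"
  by (simp add: transform_list_def)

lemma set_transform_list_subset: "set (transform_list U bs) \<subseteq> range (int_comb bs)"
  by (auto simp: transform_list_def)

lemma expresses_basis_transform_list:
  "expresses_basis A cs bs \<longleftrightarrow>
     A \<in> carrier_mat (length cs) (length bs) \<and> cs = transform_list A bs"
proof -
  have "(\<forall>i<length cs. cs ! i = int_comb bs (\<lambda>j. A $$ (i, j))) \<longleftrightarrow> cs = transform_list A bs"
    if "dim_row A = length cs"
  proof
    assume "\<forall>i<length cs. cs ! i = int_comb bs (\<lambda>j. A $$ (i, j))"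
    then show "cs = transform_list A bs"
      using that by (intro nth_equalityI) simp_all
  next
    assume cs: "cs = transform_list A bs"
    show "\<forall>i<length cs. cs ! i = int_comb bs (\<lambda>j. A $$ (i, j))"
      unfolding cs by simp
  qed
  then show ?thesis
    unfolding expresses_basis_def int_comb_def[symmetric] by (intro conj_cong refl) simp
qed

lemma int_comb_transform_list:
  "int_comb (transform_list U bs) c = int_comb bs (\<lambda>j. \<Sum>i<dim_row U. c i * U $$ (i, j))"
  using int_comb_compose[of "transform_list U bs" bs "\<lambda>i j. U $$ (i, j)" c] by simp

lemma transform_list_mult:
  assumes "A \<in> carrier_mat k n" "B \<in> carrier_mat n (length bs)"
  shows "transform_list (A * B) bs = transform_list A (transform_list B bs)"
proof (rule nth_equalityI)
  fix i assume "i < length (transform_list (A * B) bs)"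
  then have "i < k" using assms by simp
  then show "transform_list (A * B) bs ! i = transform_list A (transform_list B bs) ! i"
    using assms
    by (auto simp: int_comb_transform_list scalar_prod_def lessThan_atLeast0 intro!: int_comb_cong)
qed (use assms in simp)

lemma transform_list_one:
  assumes "length bs = n"
  shows "transform_list (1\<^sub>m n) bs = bs"
proof (rule nth_equalityI)
  fix i assume "i < length (transform_list (1\<^sub>m n) bs)"
  then have i: "i < length bs" using assms by simp
  have "int_comb bs (\<lambda>j. 1\<^sub>m n $$ (i, j)) = int_comb bs (\<lambda>j. if j = i then 1 else 0)"
    using i assms by (intro int_comb_cong) auto
  then show "transform_list (1\<^sub>m n) bs ! i = bs ! i"
    using i assms by (simp add: int_comb_nth)
qed (use assms in simp)

lemma lattice_basis_transform_list:
  fixes bs :: "'a::euclidean_space list"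
  assumes "lattice_basis bs \<Lambda>" "length bs = n"
    and "U \<in> carrier_mat n n" "U' \<in> carrier_mat n n" "U' * U = 1\<^sub>m n"
  shows "lattice_basis (transform_list U bs) \<Lambda>"
proof (rule lattice_basis_exchange[OF assms(1)])
  show "length (transform_list U bs) = length bs"
    using assms by simp
  show "set (transform_list U bs) \<subseteq> \<Lambda>"
    using assms(1) set_transform_list_subset[of U bs] by (simp add: lattice_basis_int_comb)
  have "transform_list U' (transform_list U bs) = bs"
    using transform_list_mult[of U' n n U bs] assms by (simp add: transform_list_one)
  then show "set bs \<subseteq> range (int_comb (transform_list U bs))"
    using set_transform_list_subset[of U' "transform_list U bs"] by simp
qed

lemma invertible_mat_obtain_inverse:
  assumes "invertible_mat (P :: 'b::semiring_1 mat)" "P \<in> carrier_mat n n"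
  obtains P' where "P' \<in> carrier_mat n n" "P * P' = 1\<^sub>m n" "P' * P = 1\<^sub>m n"
proof -
  obtain P' where P': "P * P' = 1\<^sub>m (dim_row P)" "P' * P = 1\<^sub>m (dim_row P')"
    using assms(1) unfolding invertible_mat_def inverts_mat_def by blast
  have "dim_row P' = n" "dim_col P' = n"
    using arg_cong[OF P'(1), of dim_col] arg_cong[OF P'(2), of dim_col] assms(2) by auto
  then show ?thesis using that[of P'] P' assms(2) by auto
qed

section \<open>Invariant factors and stacked bases\<close>

lemma transform_list_diag_nth:
  assumes "i < length bs"
  shows "transform_list (mat_diag (length bs) d) bs ! i = of_int (d i) *\<^sub>R bs ! i"
proof -
  have "transform_list (mat_diag (length bs) d) bs ! i =
      (\<Sum>j<length bs. of_int (if i = j then d j else 0) *\<^sub>R bs ! j)"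
    using assms by (simp add: mat_diag_def int_comb_def)
  also have "\<dots> = (\<Sum>j<length bs. if j = i then of_int (d i) *\<^sub>R bs ! i else 0)"
    by (intro sum.cong) auto
  finally have "transform_list (mat_diag (length bs) d) bs ! i =
      (\<Sum>j<length bs. if j = i then of_int (d i) *\<^sub>R bs ! i else 0)" .
  then show ?thesis using assms by simp
qed

lemma int_comb_transform_list_diag:
  "int_comb (transform_list (mat_diag (length bs) d) bs) c = int_comb bs (\<lambda>i. d i * c i)"
proof -
  have "int_comb (transform_list (mat_diag (length bs) d) bs) c =
      (\<Sum>i<length bs. of_int (c i) *\<^sub>R (of_int (d i) *\<^sub>R bs ! i))"
    unfolding int_comb_def by (intro sum.cong) (auto simp: transform_list_diag_nth, simp_all add: mat_diag_def)
  then show ?thesis by (simp add: int_comb_def mult.commute)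
qed

lemma range_int_comb_transform_list_diag:
  "range (int_comb (transform_list (mat_diag (length bs) d) bs)) =
     int_comb bs ` {c. \<forall>i<length bs. d i dvd c i}"
proof (intro equalityI subsetI)
  fix x assume "x \<in> range (int_comb (transform_list (mat_diag (length bs) d) bs))"
  then show "x \<in> int_comb bs ` {c. \<forall>i<length bs. d i dvd c i}"
    by (auto simp: int_comb_transform_list_diag)
next
  fix x assume "x \<in> int_comb bs ` {c. \<forall>i<length bs. d i dvd c i}"
  then obtain c where x: "x = int_comb bs c" and c: "\<forall>i<length bs. d i dvd c i"
    by auto
  have "x = int_comb bs (\<lambda>i. d i * (c i div d i))"
    unfolding x using c by (intro int_comb_cong) auto
  then show "x \<in> range (int_comb (transform_list (mat_diag (length bs) d) bs))"
    by (simp add: int_comb_transform_list_diag[symmetric])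
qed

lemma lattice_basis_transform_list_diag:
  fixes bs :: "'a::euclidean_space list"
  assumes "distinct bs" "independent (set bs)" "\<And>i. i < length bs \<Longrightarrow> d i \<noteq> 0"
  shows "lattice_basis (transform_list (mat_diag (length bs) d) bs)
    (int_comb bs ` {c. \<forall>i<length bs. d i dvd c i})"
proof -
  let ?cs = "transform_list (mat_diag (length bs) d) bs"
  have len: "length ?cs = length bs"
    by (simp add: mat_diag_def)
  have "bs ! i \<in> span (set ?cs)" if "i < length bs" for i
  proof -
    have "of_int (d i) *\<^sub>R bs ! i \<in> span (set ?cs)"
      using that len by (metis nth_mem span_base transform_list_diag_nth)
    from span_scale[OF this, of "inverse (of_int (d i))"] show ?thesis
      using assms(3)[OF that] by simp
  qed
  then have "set bs \<subseteq> span (set ?cs)"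
    by (auto simp: in_set_conv_nth)
  from distinct_independent_if_spans[OF assms(1,2) len this] show ?thesis
    by (simp add: lattice_basis_int_comb range_int_comb_transform_list_diag)
qed

text \<open>If \<open>P * A * Q = D\<close> is the Smith normal form, then \<open>P * A = D * Q\<^sup>-\<^sup>1\<close>. So the basis of
  \<open>M\<close> changed by \<open>P\<close> consists of the multiples by the \<open>d\<^sub>i\<close> of the basis of \<open>\<Lambda>\<close> changed by
  \<open>Q\<^sup>-\<^sup>1\<close>, and \<open>M\<close> becomes the set of vectors whose \<open>i\<close>-th coordinate is divisible by \<open>d\<^sub>i\<close>.
  Conversely, in stacked bases the coordinate matrix is already diagonal.\<close>
lemma has_invariant_factors_iff_stacked_basis:
  fixes \<Lambda> M :: "'a::euclidean_space set"
  shows "has_invariant_factors M \<Lambda> ds \<longleftrightarrow>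
    (\<forall>d\<in>set ds. 0 < d) \<and> (\<forall>i. Suc i < length ds \<longrightarrow> ds ! i dvd ds ! Suc i) \<and>
    (\<exists>bs. length bs = length ds \<and> lattice_basis bs \<Lambda> \<and>
       M = int_comb bs ` {c. \<forall>i<length ds. int (ds ! i) dvd c i})"
    (is "?L \<longleftrightarrow> ?pos \<and> ?chain \<and> ?stacked")
proof
  assume ?L
  define n where "n = length ds"
  define D where "D = mat_diag n (\<lambda>i. int (ds ! i))"
  obtain bs cs A P Q where bs: "length bs = n" "lattice_basis bs \<Lambda>"
    and cs: "length cs = n" "lattice_basis cs M"
    and A: "A \<in> carrier_mat n n" and cs_eq: "cs = transform_list A bs"
    and P: "P \<in> carrier_mat n n" "invertible_mat P"
    and Q: "Q \<in> carrier_mat n n" "invertible_mat Q"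
    and PAQ: "P * A * Q = D" and pos: ?pos and chain: ?chain
    using \<open>?L\<close>
    unfolding has_invariant_factors_def has_smith_normal_form_def expresses_basis_transform_list
      n_def D_def by blast
  obtain P' where P': "P' \<in> carrier_mat n n" "P' * P = 1\<^sub>m n"
    using invertible_mat_obtain_inverse[OF P(2,1)] by blast
  obtain Q' where Q': "Q' \<in> carrier_mat n n" "Q * Q' = 1\<^sub>m n"
    using invertible_mat_obtain_inverse[OF Q(2,1)] by blast
  have D: "D \<in> carrier_mat n n" by (simp add: D_def)
  have "D * Q' = P * A * (Q * Q')"
    unfolding PAQ[symmetric] using P(1) A Q(1) Q'(1) by (intro assoc_mult_mat) auto
  then have PA: "P * A = D * Q'"
    using Q'(2) P(1) A by simp
  let ?bs = "transform_list Q' bs"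
  have "transform_list P cs = transform_list (P * A) bs"
    unfolding cs_eq by (rule transform_list_mult[symmetric]) (use P A bs in auto)
  also have "\<dots> = transform_list D ?bs"
    unfolding PA by (rule transform_list_mult) (use D Q' bs in auto)
  finally have "transform_list P cs = transform_list D ?bs" .
  moreover have "lattice_basis (transform_list P cs) M"
    using lattice_basis_transform_list cs P P' by blast
  ultimately have "M = range (int_comb (transform_list D ?bs))"
    by (simp add: lattice_basis_int_comb)
  moreover have "length ?bs = n"
    using Q'(1) by simp
  ultimately have "M = int_comb ?bs ` {c. \<forall>i<n. int (ds ! i) dvd c i}"
    using range_int_comb_transform_list_diag[of ?bs "\<lambda>i. int (ds ! i)"] by (simp add: D_def)
  moreover have "lattice_basis ?bs \<Lambda>"
    using lattice_basis_transform_list bs Q Q' by blast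
  ultimately show "?pos \<and> ?chain \<and> ?stacked"
    using pos chain \<open>length ?bs = n\<close> unfolding n_def by blast
next
  assume R: "?pos \<and> ?chain \<and> ?stacked"
  define n where "n = length ds"
  define D where "D = mat_diag n (\<lambda>i. int (ds ! i))"
  obtain bs where bs: "length bs = n" "lattice_basis bs \<Lambda>"
    and M: "M = int_comb bs ` {c. \<forall>i<n. int (ds ! i) dvd c i}"
    using R unfolding n_def by blast
  have "ds ! i \<noteq> 0" if "i < n" for i
    using R that unfolding n_def by (metis nth_mem less_numeral_extra(3))
  then have "lattice_basis (transform_list D bs) M"
    using lattice_basis_transform_list_diag[of bs "\<lambda>i. int (ds ! i)"] bs
    by (simp add: M D_def lattice_basis_int_comb)
  moreover have D: "D \<in> carrier_mat n n" by (simp add: D_def)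
  moreover have "expresses_basis D (transform_list D bs) bs"
    using D bs by (simp add: expresses_basis_transform_list)
  moreover have "has_smith_normal_form D ds"
  proof -
    have "invertible_mat (1\<^sub>m n :: int mat)"
      by (auto simp: invertible_mat_def inverts_mat_def intro!: exI[of _ "1\<^sub>m n"])
    moreover have "1\<^sub>m n * D * 1\<^sub>m n = D"
      using D by simp
    ultimately show ?thesis
      using R D unfolding has_smith_normal_form_def n_def[symmetric] D_def[symmetric]
      by (intro conjI exI[of _ "1\<^sub>m n"]) auto
  qed
  ultimately show ?L
    using bs unfolding has_invariant_factors_def n_def[symmetric]
    by (intro exI[of _ bs] exI[of _ "transform_list D bs"] exI[of _ D]) auto
qed

section \<open>Concentrating a functional on one basis vector\<close>

lemma nth_in_range_int_comb: "i < length bs \<Longrightarrow> bs ! i \<in> range (int_comb bs)"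
  by (metis int_comb_nth rangeI)

lemma range_int_comb_add_scale:
  assumes "x \<in> range (int_comb bs)" "y \<in> range (int_comb bs)"
  shows "x + of_int k *\<^sub>R y \<in> range (int_comb bs)"
proof -
  obtain c d where "x = int_comb bs c" "y = int_comb bs d"
    using assms by blast
  then have "x + of_int k *\<^sub>R y = int_comb bs (\<lambda>i. c i + k * d i)"
    by (simp add: int_comb_def sum.distrib scaleR_add_left scaleR_sum_right)
  then show ?thesis by blast
qed

lemma lattice_basis_transvection:
  fixes bs :: "'a::euclidean_space list"
  assumes "lattice_basis bs \<Lambda>" "i < length bs" "j < length bs" "i \<noteq> j"
  shows "lattice_basis (bs[i := bs ! i + of_int s *\<^sub>R bs ! j]) \<Lambda>"
proof (rule lattice_basis_exchange[OF assms(1)])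
  let ?bs = "bs[i := bs ! i + of_int s *\<^sub>R bs ! j]"
  have \<Lambda>: "\<Lambda> = range (int_comb bs)"
    using assms(1) by (simp add: lattice_basis_int_comb)
  have "set bs \<subseteq> \<Lambda>"
    using nth_in_range_int_comb unfolding \<Lambda> by (metis in_set_conv_nth subsetI)
  moreover have "bs ! i + of_int s *\<^sub>R bs ! j \<in> \<Lambda>"
    unfolding \<Lambda> by (intro range_int_comb_add_scale nth_in_range_int_comb assms)
  ultimately show "set ?bs \<subseteq> \<Lambda>"
    by (rule set_update_subsetI)
  show "set bs \<subseteq> range (int_comb ?bs)"
  proof
    fix b assume "b \<in> set bs"
    then obtain k where k: "k < length bs" "b = bs ! k"
      by (metis in_set_conv_nth)
    have new: "?bs ! l \<in> range (int_comb ?bs)" if "l < length bs" for l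
      by (rule nth_in_range_int_comb) (use that in simp)
    show "b \<in> range (int_comb ?bs)"
    proof (cases "k = i")
      case True
      have "?bs ! i + of_int (- s) *\<^sub>R ?bs ! j \<in> range (int_comb ?bs)"
        by (intro range_int_comb_add_scale new assms)
      moreover have "?bs ! i + of_int (- s) *\<^sub>R ?bs ! j = b"
        using assms k True by simp
      ultimately show ?thesis by simp
    next
      case False
      then show ?thesis using new[OF k(1)] k(2) by simp
    qed
  qed
qed simp

lemma lattice_basis_swap:
  fixes bs :: "'a::euclidean_space list"
  assumes "lattice_basis bs \<Lambda>" "i < length bs" "j < length bs"
  shows "lattice_basis (bs[i := bs ! j, j := bs ! i]) \<Lambda>"
proof (rule lattice_basis_exchange[OF assms(1)])
  let ?bs = "bs[i := bs ! j, j := bs ! i]"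
  have same: "set ?bs = set bs"
    using assms(2,3) by (rule set_swap)
  have in_range: "set xs \<subseteq> range (int_comb xs)" for xs :: "'a list"
    using nth_in_range_int_comb by (metis in_set_conv_nth subsetI)
  show "set ?bs \<subseteq> \<Lambda>"
    unfolding same using in_range[of bs] assms(1) by (simp add: lattice_basis_int_comb)
  show "set bs \<subseteq> range (int_comb ?bs)"
    using in_range[of ?bs] unfolding same .
qed simp

text \<open>The Euclidean algorithm on the values of \<open>f\<close> at the basis: as long as two of them are
  nonzero, adding or subtracting the vector with the smaller value decreases the sum of the
  absolute values. A single remaining nonzero value is moved to the last position.\<close>
lemma lattice_basis_concentrating_functional:
  fixes f :: "'a::euclidean_space \<Rightarrow> real"
  assumes "linear f" "lattice_basis bs \<Lambda>" "length bs = n" "\<And>i. i < n \<Longrightarrow> f (bs ! i) \<in> \<int>"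
  shows "\<exists>bs'. length bs' = n \<and> lattice_basis bs' \<Lambda> \<and> (\<forall>i. Suc i < n \<longrightarrow> f (bs' ! i) = 0)"
  using assms(2-)
proof (induction "\<Sum>i<n. nat \<bar>\<lfloor>f (bs ! i)\<rfloor>\<bar>" arbitrary: bs rule: less_induct)
  case less
  note basis = less.prems(1) and len = less.prems(2) and ints = less.prems(3)
  show ?case
  proof (cases "\<exists>i<n. \<exists>j<n. i \<noteq> j \<and> f (bs ! j) \<noteq> 0 \<and> \<bar>f (bs ! j)\<bar> \<le> \<bar>f (bs ! i)\<bar>")
    case True
    then obtain i j where ij: "i < n" "j < n" "i \<noteq> j"
      and nz: "f (bs ! j) \<noteq> 0" and le: "\<bar>f (bs ! j)\<bar> \<le> \<bar>f (bs ! i)\<bar>"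
      by blast
    obtain a b where a: "f (bs ! i) = of_int a" and b: "f (bs ! j) = of_int b"
      using ints ij by (meson Ints_cases)
    \<comment> \<open>The sign for which adding \<open>s\<close> times the \<open>j\<close>-th vector moves the larger value towards 0.\<close>
    define s where "s = - (sgn a * sgn b)"
    have "b \<noteq> 0" "\<bar>b\<bar> \<le> \<bar>a\<bar>"
      using nz le unfolding a b by linarith+
    then have smaller: "\<bar>a + s * b\<bar> < \<bar>a\<bar>"
      by (auto simp: s_def sgn_if split: if_splits)
    define bs' where "bs' = bs[i := bs ! i + of_int s *\<^sub>R bs ! j]"
    have f': "f (bs' ! i) = of_int (a + s * b)"
      using ij len assms(1) by (simp add: bs'_def linear_add linear_scale a b)
    have same: "bs' ! k = bs ! k" if "k \<noteq> i" for k
      using that by (simp add: bs'_def)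
    show ?thesis
    proof (rule less.hyps)
      have "nat \<bar>\<lfloor>f (bs' ! k)\<rfloor>\<bar> \<le> nat \<bar>\<lfloor>f (bs ! k)\<rfloor>\<bar>" for k
        using smaller f' a same by (cases "k = i") (auto simp del: of_int_add of_int_mult)
      moreover have "nat \<bar>\<lfloor>f (bs' ! i)\<rfloor>\<bar> < nat \<bar>\<lfloor>f (bs ! i)\<rfloor>\<bar>"
        unfolding f' a floor_of_int using smaller by simp
      ultimately show "(\<Sum>k<n. nat \<bar>\<lfloor>f (bs' ! k)\<rfloor>\<bar>) < (\<Sum>k<n. nat \<bar>\<lfloor>f (bs ! k)\<rfloor>\<bar>)"
        using ij(1) by (intro sum_strict_mono_ex1) auto
      show "lattice_basis bs' \<Lambda>"
        unfolding bs'_def using lattice_basis_transvection basis ij len by blast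
      show "length bs' = n" using len by (simp add: bs'_def)
      show "f (bs' ! k) \<in> \<int>" if "k < n" for k
        using f' same ints[OF that] by (cases "k = i") (simp_all del: of_int_add of_int_mult)
    qed
  next
    case False
    then have single: "f (bs ! i) = 0 \<or> f (bs ! j) = 0" if "i < n" "j < n" "i \<noteq> j" for i j
      using that by (metis linear)
    show ?thesis
    proof (cases "\<exists>i. Suc i < n \<and> f (bs ! i) \<noteq> 0")
      case True
      then obtain i where i: "Suc i < n" "f (bs ! i) \<noteq> 0" by blast
      define bs' where "bs' = bs[i := bs ! (n - 1), n - 1 := bs ! i]"
      have zero: "f (bs ! k) = 0" if "k < n" "k \<noteq> i" for k
        using single[of k i] that i by auto
      have "f (bs' ! k) = 0" if "Suc k < n" for k
        using that i len zero[of k] zero[of "n - 1"]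
        by (cases "k = i") (auto simp: bs'_def)
      moreover have "lattice_basis bs' \<Lambda>"
        unfolding bs'_def using i len by (intro lattice_basis_swap basis) auto
      moreover have "length bs' = n" using len by (simp add: bs'_def)
      ultimately show ?thesis by blast
    next
      case False
      then show ?thesis using basis len by blast
    qed
  qed
qed

section \<open>Sublattices with cyclic quotient\<close>

text \<open>The right-hand side does not mention the basis. Comparing two bases of \<open>\<Lambda>\<close> therefore
  amounts to evaluating one and the same linear functional on both of them.\<close>
lemma int_comb_congruence_set:
  fixes f :: "'a::euclidean_space \<Rightarrow> real"
  assumes "lattice_basis bs \<Lambda>" "length bs = n" "linear f"
    and "\<And>i. i < n \<Longrightarrow> f (bs ! i) = of_int (v i)"
  shows "int_comb bs ` congruence_set n m v = {x \<in> \<Lambda>. \<exists>k::int. f x = of_int (int m * k)}"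
proof -
  have "f (int_comb bs c) = of_int (\<Sum>i<n. v i * c i)" for c
    unfolding linear_int_comb[OF assms(3)] assms(2) by (simp add: assms(4) mult.commute)
  then have "c \<in> congruence_set n m v \<longleftrightarrow> (\<exists>k::int. f (int_comb bs c) = of_int (int m * k))" for c
    by (simp only: congruence_set_def mem_Collect_eq dvd_def of_int_eq_iff)
  moreover have "\<Lambda> = range (int_comb bs)"
    using assms(1) by (simp add: lattice_basis_int_comb)
  ultimately show ?thesis by auto
qed

definition last_coordinate :: "nat \<Rightarrow> nat \<Rightarrow> int" where
  "last_coordinate n i = (if i = n - 1 then 1 else 0)"

lemma sum_last_coordinate:
  assumes "n \<ge> 1"
  shows "(\<Sum>i<n. last_coordinate n i * c i) = c (n - 1)"
proof -
  have "(\<Sum>i<n. last_coordinate n i * c i) = (\<Sum>i<n. if i = n - 1 then c i else 0)"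
    by (intro sum.cong) (auto simp: last_coordinate_def)
  then show ?thesis using assms by simp
qed

text \<open>In a stacked basis only the last coordinate is constrained, which is a congruence
  condition with the last coordinate as covector.\<close>
lemma has_cocyclic_invariant_factors_iff:
  fixes \<Lambda> M :: "'a::euclidean_space set"
  assumes "n \<ge> 1" "m > 0"
  shows "has_invariant_factors M \<Lambda> (replicate (n - 1) 1 @ [m]) \<longleftrightarrow>
    (\<exists>bs. length bs = n \<and> lattice_basis bs \<Lambda> \<and>
       M = int_comb bs ` congruence_set n m (last_coordinate n))"
proof -
  let ?ds = "replicate (n - 1) 1 @ [m]"
  have len: "length ?ds = n" using assms(1) by simp
  have nth: "?ds ! i = (if i = n - 1 then m else 1)" if "i < n" for i
    using that by (auto simp: nth_append)
  have "(\<forall>i<n. int (?ds ! i) dvd c i) \<longleftrightarrow> int m dvd c (n - 1)" for c :: "nat \<Rightarrow> int"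
  proof -
    have entry: "int (?ds ! i) dvd c i \<longleftrightarrow> (i = n - 1 \<longrightarrow> int m dvd c i)" if "i < n" for i
      unfolding nth[OF that] by simp
    have "n - 1 < n" using assms(1) by simp
    then show ?thesis using entry by blast
  qed
  then have "{c. \<forall>i<n. int (?ds ! i) dvd c i} = congruence_set n m (last_coordinate n)"
    unfolding congruence_set_def sum_last_coordinate[OF assms(1)] by blast
  moreover have "\<forall>d\<in>set ?ds. 0 < d"
    using assms(2) by auto
  moreover have "\<forall>i. Suc i < n \<longrightarrow> ?ds ! i dvd ?ds ! Suc i"
  proof (intro allI impI)
    fix i assume i: "Suc i < n"
    then have "i < n" by simp
    show "?ds ! i dvd ?ds ! Suc i"
      unfolding nth[OF i] nth[OF \<open>i < n\<close>] using i by auto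
  qed
  ultimately show ?thesis
    unfolding has_invariant_factors_iff_stacked_basis len by simp
qed

text \<open>The last coordinate in a stacked basis is a functional \<open>f\<close> on \<open>\<Lambda>\<close>, and \<open>v\<close> lists its
  values on the basis \<open>bs\<close>. Since \<open>f\<close> takes the value 1 on \<open>\<Lambda>\<close>, no prime divides all these
  values.\<close>
lemma cocyclic_sublattice_imp_congruence:
  fixes \<Lambda> M :: "'a::euclidean_space set"
  assumes "n \<ge> 1" "m > 0" "lattice_basis bs \<Lambda>" "length bs = n"
    and "has_invariant_factors M \<Lambda> (replicate (n - 1) 1 @ [m])"
  obtains v where "primitive_mod n m v" "M = int_comb bs ` congruence_set n m v"
proof -
  obtain bs' where bs': "length bs' = n" "lattice_basis bs' \<Lambda>"
    and M: "M = int_comb bs' ` congruence_set n m (last_coordinate n)"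
    using assms(5) has_cocyclic_invariant_factors_iff[OF assms(1,2)] by blast
  have \<Lambda>: "\<Lambda> = range (int_comb bs)" "\<Lambda> = range (int_comb bs')"
    using assms(3) bs'(2) by (auto simp: lattice_basis_int_comb)
  have "distinct bs'" "independent (set bs')"
    using bs'(2) by (auto simp: lattice_basis_int_comb)
  from linear_extend_list[OF this, of "\<lambda>i. of_int (last_coordinate n i)"]
  obtain f :: "'a \<Rightarrow> real" where f: "linear f"
    and f_bs': "\<And>i. i < n \<Longrightarrow> f (bs' ! i) = of_int (last_coordinate n i)"
    unfolding bs'(1) by blast
  have "f (bs ! i) \<in> \<int>" if "i < n" for i
  proof -
    have "bs ! i \<in> \<Lambda>"
      unfolding \<Lambda>(1) by (rule nth_in_range_int_comb) (use that assms(4) in simp)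
    then obtain c where "bs ! i = int_comb bs' c"
      unfolding \<Lambda>(2) by blast
    then have "f (bs ! i) = (\<Sum>k<n. of_int (c k) *\<^sub>R of_int (last_coordinate n k))"
      using linear_int_comb[OF f, of bs' c] f_bs' bs'(1) by simp
    also have "\<dots> = of_int (\<Sum>k<n. c k * last_coordinate n k)"
      by simp
    finally show ?thesis by (simp only: Ints_of_int)
  qed
  then have "\<forall>i. \<exists>a. i < n \<longrightarrow> f (bs ! i) = of_int a"
    by (meson Ints_cases)
  then obtain v where v: "\<And>i. i < n \<Longrightarrow> f (bs ! i) = of_int (v i)"
    by metis
  have "M = {x \<in> \<Lambda>. \<exists>k::int. f x = of_int (int m * k)}"
    unfolding M by (rule int_comb_congruence_set) (use bs' f f_bs' in auto)
  also have "\<dots> = int_comb bs ` congruence_set n m v"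
    by (rule int_comb_congruence_set[symmetric]) (use assms(3,4) f v in auto)
  finally have "M = int_comb bs ` congruence_set n m v" .
  moreover have "primitive_mod n m v"
    unfolding primitive_mod_def
  proof (intro allI impI, rule ccontr)
    fix q assume q: "prime q" "q dvd m" and "\<not> (\<exists>i<n. \<not> int q dvd v i)"
    then have dvd: "int q dvd (\<Sum>i<n. v i * c i)" for c
      by (intro dvd_sum dvd_mult2) auto
    have "bs' ! (n - 1) \<in> \<Lambda>"
      unfolding \<Lambda>(2) by (rule nth_in_range_int_comb) (use bs'(1) assms(1) in simp)
    then obtain c where c: "bs' ! (n - 1) = int_comb bs c"
      unfolding \<Lambda>(1) by blast
    have "1 = f (int_comb bs c)"
      using f_bs'[of "n - 1"] assms(1) c by (simp add: last_coordinate_def)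
    also have "\<dots> = of_int (\<Sum>i<n. v i * c i)"
      unfolding linear_int_comb[OF f] assms(4) by (simp add: v mult.commute)
    finally have "(\<Sum>i<n. v i * c i) = 1" by linarith
    then show False using dvd[of c] prime_gt_1_nat[OF q(1)] by simp
  qed
  ultimately show ?thesis using that by blast
qed

text \<open>In a basis that concentrates the functional with values \<open>v\<close>, it is \<open>g\<close> times the last
  coordinate, where \<open>g\<close> divides every entry of \<open>v\<close>. As \<open>v\<close> is primitive modulo \<open>m\<close>, \<open>g\<close> is a
  unit modulo \<open>m\<close> and can be dropped from the congruence, which leaves a stacked basis.\<close>
lemma congruence_imp_cocyclic_sublattice:
  fixes \<Lambda> :: "'a::euclidean_space set"
  assumes "n \<ge> 1" "m > 0" "lattice_basis bs \<Lambda>" "length bs = n" "primitive_mod n m v"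
  shows "has_invariant_factors (int_comb bs ` congruence_set n m v) \<Lambda> (replicate (n - 1) 1 @ [m])"
proof -
  have "distinct bs" "independent (set bs)"
    using assms(3) by (auto simp: lattice_basis_int_comb)
  from linear_extend_list[OF this, of "\<lambda>i. of_int (v i)"]
  obtain f :: "'a \<Rightarrow> real" where f: "linear f" and f_bs: "\<And>i. i < n \<Longrightarrow> f (bs ! i) = of_int (v i)"
    unfolding assms(4) by blast
  have ints: "f (bs ! i) \<in> \<int>" if "i < n" for i
    using f_bs[OF that] by simp
  obtain bs' where bs': "length bs' = n" "lattice_basis bs' \<Lambda>"
    and zero: "\<And>i. Suc i < n \<Longrightarrow> f (bs' ! i) = 0"
    using lattice_basis_concentrating_functional[OF f assms(3,4) ints] by blast
  have \<Lambda>: "\<Lambda> = range (int_comb bs)" "\<Lambda> = range (int_comb bs')"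
    using assms(3) bs'(2) by (auto simp: lattice_basis_int_comb)
  have f_comb: "f (int_comb bs c) = of_int (\<Sum>i<n. v i * c i)" for c
    unfolding linear_int_comb[OF f] assms(4) by (simp add: f_bs mult.commute)
  have "bs' ! (n - 1) \<in> \<Lambda>"
    unfolding \<Lambda>(2) by (rule nth_in_range_int_comb) (use bs'(1) assms(1) in simp)
  then obtain c where c: "bs' ! (n - 1) = int_comb bs c"
    unfolding \<Lambda>(1) by blast
  define g where "g = (\<Sum>i<n. v i * c i)"
  have f_bs': "f (bs' ! i) = of_int (g * last_coordinate n i)" if "i < n" for i
    using that zero[of i] c f_comb[of c] by (cases "i = n - 1") (auto simp: g_def last_coordinate_def)
  have g_dvd: "g dvd v i" if i: "i < n" for i
  proof -
    have "bs ! i \<in> \<Lambda>"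
      unfolding \<Lambda>(1) by (rule nth_in_range_int_comb) (use i assms(4) in simp)
    then obtain d where d: "bs ! i = int_comb bs' d"
      unfolding \<Lambda>(2) by blast
    have "of_int (v i) = f (int_comb bs' d)"
      using d f_bs[OF i] by simp
    also have "\<dots> = of_int (\<Sum>k<n. d k * (g * last_coordinate n k))"
      unfolding linear_int_comb[OF f] bs'(1) by (simp add: f_bs')
    finally have "v i = (\<Sum>k<n. d k * (g * last_coordinate n k))"
      by (simp only: of_int_eq_iff)
    also have "g dvd \<dots>" by (intro dvd_sum) simp
    finally show ?thesis .
  qed
  have "coprime g (int m)"
  proof (rule ccontr)
    assume "\<not> coprime g (int m)"
    then have "\<not> coprime (nat \<bar>g\<bar>) m"
      by simp
    then have "gcd (nat \<bar>g\<bar>) m \<noteq> 1"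
      by (simp only: coprime_iff_gcd_eq_1 not_False_eq_True)
    then obtain q where q: "prime q" "q dvd gcd (nat \<bar>g\<bar>) m"
      using prime_factor_nat by blast
    then have "q dvd nat \<bar>g\<bar>" "q dvd m"
      by (meson gcd_dvd1 gcd_dvd2 dvd_trans)+
    then have "int q dvd g" "q dvd m"
      by simp_all
    then show False
      using assms(5) q(1) g_dvd unfolding primitive_mod_def by (meson dvd_trans)
  qed
  have "int_comb bs ` congruence_set n m v = {x \<in> \<Lambda>. \<exists>k::int. f x = of_int (int m * k)}"
    by (rule int_comb_congruence_set) (use assms(3,4) f f_bs in auto)
  also have "\<dots> = int_comb bs' ` congruence_set n m (\<lambda>i. g * last_coordinate n i)"
    by (rule int_comb_congruence_set[symmetric]) (use bs' f f_bs' in auto)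
  also have "\<dots> = int_comb bs' ` congruence_set n m (last_coordinate n)"
    using congruence_set_scale[OF \<open>coprime g (int m)\<close>, of n "last_coordinate n"] by simp
  finally show ?thesis
    using has_cocyclic_invariant_factors_iff[OF assms(1,2)] bs' by blast
qed

lemma cocyclic_sublattices_eq:
  fixes \<Lambda> :: "'a::euclidean_space set"
  assumes "n \<ge> 1" "m > 0" "lattice_basis bs \<Lambda>" "length bs = n"
  shows "{M. is_sublattice n M \<Lambda> \<and> has_invariant_factors M \<Lambda> (replicate (n - 1) 1 @ [m])} =
    (\<lambda>S. int_comb bs ` S) ` primitive_congruence_sets n m"
proof (intro equalityI subsetI)
  fix M assume "M \<in> {M. is_sublattice n M \<Lambda> \<and> has_invariant_factors M \<Lambda> (replicate (n - 1) 1 @ [m])}"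
  then obtain v where "primitive_mod n m v" "M = int_comb bs ` congruence_set n m v"
    using cocyclic_sublattice_imp_congruence[OF assms] by blast
  then show "M \<in> (\<lambda>S. int_comb bs ` S) ` primitive_congruence_sets n m"
    by (auto simp: primitive_congruence_sets_def)
next
  fix M assume "M \<in> (\<lambda>S. int_comb bs ` S) ` primitive_congruence_sets n m"
  then obtain v where v: "primitive_mod n m v" and M: "M = int_comb bs ` congruence_set n m v"
    by (auto simp: primitive_congruence_sets_def)
  have inv: "has_invariant_factors M \<Lambda> (replicate (n - 1) 1 @ [m])"
    unfolding M using congruence_imp_cocyclic_sublattice[OF assms v] .
  then have "is_lattice n M"
    using assms(1) unfolding has_invariant_factors_def is_lattice_def by auto
  moreover have "M \<subseteq> \<Lambda>"
    using assms(3) by (auto simp: M lattice_basis_int_comb)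
  ultimately show "M \<in> {M. is_sublattice n M \<Lambda> \<and> has_invariant_factors M \<Lambda> (replicate (n - 1) 1 @ [m])}"
    using inv by (simp add: is_sublattice_def)
qed

text \<open>Distinct functions can have the same integer combination, but only if they agree below
  \<open>n\<close>, and congruence sets do not separate such functions.\<close>
lemma inj_on_int_comb_image:
  assumes "distinct bs" "independent (set bs)" "length bs = n"
  shows "inj_on (\<lambda>S. int_comb bs ` S) (primitive_congruence_sets n m)"
proof (rule inj_onI)
  fix S T
  assume "S \<in> primitive_congruence_sets n m" "T \<in> primitive_congruence_sets n m"
    and eq: "int_comb bs ` S = int_comb bs ` T"
  moreover have "c \<in> S \<longleftrightarrow> int_comb bs c \<in> int_comb bs ` S"
    if S: "S \<in> primitive_congruence_sets n m" for S c
  proof -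
    obtain v where S: "S = congruence_set n m v"
      using S by (auto simp: primitive_congruence_sets_def)
    have "c \<in> S" if "int_comb bs c = int_comb bs d" "d \<in> S" for d
    proof -
      have "\<forall>i<n. c i = d i"
        using that(1) int_comb_eq_iff[OF assms(1,2)] assms(3) by simp
      then have "(\<Sum>i<n. v i * c i) = (\<Sum>i<n. v i * d i)"
        by (intro sum.cong) auto
      then show ?thesis using that(2) by (simp add: S congruence_set_def)
    qed
    then show ?thesis by blast
  qed
  ultimately show "S = T" by blast
qed

theorem corollary5p1:
  fixes \<Lambda> :: "'a::euclidean_space set"
    and n l m :: nat
    and p :: "nat \<Rightarrow> nat"
  assumes "n \<ge> 1"
    and "is_lattice n \<Lambda>"
    and "\<forall>k\<in>{1..l}. prime (p k)"
    and "inj_on p {1..l}"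
    and "m = (\<Prod>k=1..l. p k)"
  shows "real (num_sublattices \<Lambda> (replicate (n - 1) 1 @ [m])) =
           (\<Prod>k=1..l. (real (p k) ^ n - 1) / (real (p k) - 1))"
proof -
  obtain bs where bs: "length bs = n" "lattice_basis bs \<Lambda>"
    using assms(2) unfolding is_lattice_def by blast
  have m: "m > 0"
    unfolding assms(5) using assms(3) by (intro prod_pos) (auto simp: prime_gt_0_nat)
  have "num_sublattices \<Lambda> (replicate (n - 1) 1 @ [m]) =
      card ((\<lambda>S. int_comb bs ` S) ` primitive_congruence_sets n m)"
    using cocyclic_sublattices_eq[OF assms(1) m bs(2,1)] assms(1)
    unfolding num_sublattices_def by simp
  also have "\<dots> = card (primitive_congruence_sets n m)"
    using bs inj_on_int_comb_image by (intro card_image) (auto simp: lattice_basis_int_comb)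
  also have "real \<dots> = (\<Prod>k=1..l. (real (p k) ^ n - 1) / (real (p k) - 1))"
    unfolding assms(5) using assms(3,4) by (intro card_primitive_congruence_sets_squarefree) auto
  finally show ?thesis .
qed

end
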